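(* Let $n>3$. For each of the Wolfram rules $k$ listed below, every periodic state of rule $k$ on the circular graph with $n$ vertices is fixed by all local update functions (so the dynamics group $G_k$ is trivial and the number of its orbits is $o_k=|P_k|$), and the set $P_k$ of periodic states is as follows: \begin{itemize} \item $P_k=\{\mathbf{0}\}$ for $k=0,8,32,40$; \item $P_k=\{\mathbf{0},\mathbf{1}\}$ for $k=128,136,160,168,152,184$; \item $P_k=N_A$ for $k=4,12$, and $P_k=N_A\cup\{\mathbf{1}\}$ for $k=132,140$; \item $P_k=N_{AB}$ for $k=5,13$, and $P_k=N_{AB}\cup\{\mathbf{1}\}$ for $k=133,141$; \item $P_k=N_{AE}\cup\{\mathbf{1}\}$ for $k=164,172$; \item $P_{77}=N_{BC}$, $P_{76}=N_C$, $P_{72}=N_{CD}$, $P_{200}=N_D$, $P_{232}=N_{DE}$; \item $P_{204}=\mathbb{F}_2^n$. \end{itemize}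
   Context: Indices are taken modulo $n$. For $0\le k\le 255$ write $k=\sum_{j=0}^7 a_j2^j$ with $a_j\in\{0,1\}$ and let $f_k(a,b,c)=a_{4a+2b+c}$ for $a,b,c\in\{0,1\}$. The local update function $F_i$ of Wolfram rule $k$ is the map $\mathbb{F}_2^n\to\mathbb{F}_2^n$ replacing $y_i$ by $f_k(y_{i-1},y_i,y_{i+1})$ and leaving all other coordinates unchanged. All the rules listed are $\pi$-independent: for a simple update order $\pi$ (a sequence $\pi_1,\dots,\pi_n$ containing each of $1,\dots,n$ exactly once) the set of states periodic under iteration of $F_{\pi_n}\circ\cdots\circ F_{\pi_1}$ does not depend on $\pi$; this set is $P_k$. The dynamics group $G_k$ is the group of permutations of $P_k$ generated by the restrictions of $F_1,\dots,F_n$ to $P_k$. $\mathbf{0}$ and $\mathbf{1}$ are the all-$0$ and all-$1$ states. Abbreviations: $A=$`11', $B=$`000', $C=$`111', $D=$`010', $E=$`101'. $N_{XY\ldots}$ is the set of states in $\mathbb{F}_2^n$ containing none of the words $X,Y,\ldots$ as a (cyclic, contiguous) subword. *)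

theory Defs
  imports
    "HOL-Library.Z2"
    "HOL-Algebra.Bij"
    "HOL-Algebra.Elementary_Groups"
    "HOL-Algebra.Group_Action"
begin

text \<open>
  A state in \<open>F\<^sub>2\<^sup>n\<close> is a list of length \<open>n\<close> over the field type \<^typ>\<open>bit\<close>.  The vertices of the
  circular graph are the residues \<open>0, \<dots>, n - 1\<close> modulo \<open>n\<close>, so that vertex \<open>n\<close> is vertex \<open>0\<close>.
\<close>

definition states :: "nat \<Rightarrow> bit list set" where
  "states n = {y. length y = n}"

definition zero_state :: "nat \<Rightarrow> bit list" where
  "zero_state n = replicate n 0"

definition one_state :: "nat \<Rightarrow> bit list" where
  "one_state n = replicate n 1"

definition wolfram_digit :: "nat \<Rightarrow> nat \<Rightarrow> bit" where
  "wolfram_digit k j = of_nat (k div 2 ^ j mod 2)"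

definition wolfram_fun :: "nat \<Rightarrow> bit \<Rightarrow> bit \<Rightarrow> bit \<Rightarrow> bit" where
  "wolfram_fun k a b c = wolfram_digit k (4 * of_bit a + 2 * of_bit b + of_bit c)"

text \<open>The left neighbour \<open>i - 1\<close> is written \<open>i + n - 1\<close> because of truncated subtraction.\<close>

definition local_update :: "nat \<Rightarrow> nat \<Rightarrow> nat \<Rightarrow> bit list \<Rightarrow> bit list" where
  "local_update k n i y =
     y[i := wolfram_fun k (y ! ((i + n - 1) mod n)) (y ! i) (y ! ((i + 1) mod n))]"

definition simple_update_order :: "nat \<Rightarrow> nat list \<Rightarrow> bool" where
  "simple_update_order n \<pi> \<longleftrightarrow> distinct \<pi> \<and> set \<pi> = {..<n}"

text \<open>The head of \<open>\<pi>\<close> is applied first: \<open>F\<^bsub>\<pi>\<^sub>n\<^esub> \<circ> \<cdots> \<circ> F\<^bsub>\<pi>\<^sub>1\<^esub>\<close>.\<close>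

definition system_update :: "nat \<Rightarrow> nat \<Rightarrow> nat list \<Rightarrow> bit list \<Rightarrow> bit list" where
  "system_update k n \<pi> = fold (local_update k n) \<pi>"

definition periodic_states :: "nat \<Rightarrow> nat \<Rightarrow> nat list \<Rightarrow> bit list set" where
  "periodic_states k n \<pi> = {y \<in> states n. \<exists>m>0. (system_update k n \<pi> ^^ m) y = y}"

text \<open>
  The group of permutations of a set \<open>P\<close> of states generated by the restrictions of the local
  update functions.  \<open>generate\<close> is used rather than \<open>subgroup_generated\<close>, which would silently
  discard a generator that fails to be a permutation of \<open>P\<close>.
\<close>

definition dynamics_group ::
  "nat \<Rightarrow> nat \<Rightarrow> bit list set \<Rightarrow> (bit list \<Rightarrow> bit list) monoid" where
  "dynamics_group k n P =
     (BijGroup P)\<lparr>carrier :=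
        generate (BijGroup P) ((\<lambda>i. restrict (local_update k n i) P) ` {..<n})\<rparr>"

definition num_orbits :: "nat \<Rightarrow> nat \<Rightarrow> bit list set \<Rightarrow> nat" where
  "num_orbits k n P = card (orbits (dynamics_group k n P) P (\<lambda>g. g))"

definition cyclic_subword :: "bit list \<Rightarrow> bit list \<Rightarrow> bool" where
  "cyclic_subword w y \<longleftrightarrow>
     (\<exists>i<length y. \<forall>j<length w. y ! ((i + j) mod length y) = w ! j)"

definition avoiding :: "nat \<Rightarrow> bit list set \<Rightarrow> bit list set" where
  "avoiding n W = {y \<in> states n. \<forall>w\<in>W. \<not> cyclic_subword w y}"

definition word_A :: "bit list" where "word_A = [1, 1]"
definition word_B :: "bit list" where "word_B = [0, 0, 0]"
definition word_C :: "bit list" where "word_C = [1, 1, 1]"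
definition word_D :: "bit list" where "word_D = [0, 1, 0]"
definition word_E :: "bit list" where "word_E = [1, 0, 1]"

definition listed_rules :: "nat set" where
  "listed_rules =
     {0, 8, 32, 40} \<union>
     {128, 136, 160, 168, 152, 184} \<union>
     {4, 12} \<union> {132, 140} \<union>
     {5, 13} \<union> {133, 141} \<union>
     {164, 172} \<union>
     {77, 76, 72, 200, 232} \<union>
     {204}"

end

theory Submission
  imports Defs
begin

text \<open>
  Everything reduces to one claim: a periodic state is fixed by every local update.  Once this is
  known, the generators of the dynamics group are all the identity, and being fixed is a
  condition on the windows of three consecutive cells, which is compared with the
  forbidden words rule by rule.

  The claim is proved along the trajectory that performs one local update per time step, running
  through the order \<open>\<pi>\<close> again and again; a periodic state has a periodic trajectory, and
  any integer that never increases along it is constant.  For all but four rules some energy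
  \<open>\<Sum>i. g (y i) (y (i + 1))\<close> drops strictly at every update that changes the state
  (lemma \<open>fixed_if_energy_decreases\<close>), so that nothing ever changes.  Three choices of \<open>g\<close>
  suffice: the number of ones, the number of boundaries plus the number of ones, and twice the
  number of pairs \<open>11\<close> minus the number of ones.

  Rules 32, 40, 152 and 184 admit no such energy, since there a cell can change back and forth
  between fixed neighbours.  Here one uses that adjacent cells are updated alternately.
  For rules 32 and 40 a cell with right neighbour \<open>0\<close> becomes \<open>0\<close>, and this leaves no moment at
  which a cell could turn from \<open>0\<close> to \<open>1\<close> (lemma \<open>fixed_if_no_births\<close>).  For rules 152 and 184
  the pairs \<open>01\<close> can only disappear, hence stay in place on a periodic trajectory, while a
  boundary \<open>10\<close> that moves left once would have to move left forever and so run into a pair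
  \<open>01\<close> (lemma \<open>fixed_if_boundary_drifts\<close>).
\<close>

section \<open>Cyclic neighbours\<close>

definition lnbr :: "nat \<Rightarrow> nat \<Rightarrow> nat" where
  "lnbr n i = (i + n - 1) mod n"

definition rnbr :: "nat \<Rightarrow> nat \<Rightarrow> nat" where
  "rnbr n i = (i + 1) mod n"

lemma nbr_lt [simp]: "i < n \<Longrightarrow> lnbr n i < n" "i < n \<Longrightarrow> rnbr n i < n"
  by (simp_all add: lnbr_def rnbr_def)

lemma lnbr_rnbr [simp]: "i < n \<Longrightarrow> lnbr n (rnbr n i) = i"
  by (cases "i + 1 = n") (auto simp: lnbr_def rnbr_def)

lemma rnbr_lnbr [simp]: "i < n \<Longrightarrow> rnbr n (lnbr n i) = i"
  by (cases "i = 0") (auto simp: lnbr_def rnbr_def mod_if)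

lemma nbr_neq:
  assumes "n > 1" "i < n"
  shows "lnbr n i \<noteq> i" "rnbr n i \<noteq> i"
  using assms by (cases "i = 0"; cases "i + 1 = n"; auto simp: lnbr_def rnbr_def mod_if)+

lemma all_lnbr: "(\<forall>i<n. P (lnbr n i)) \<longleftrightarrow> (\<forall>i<n. P i)"
  by (metis lnbr_rnbr nbr_lt)

lemma spread_right:
  assumes step: "\<And>i. i < n \<Longrightarrow> P i \<Longrightarrow> P (rnbr n i)" and "j < n" "P j" "i < n"
  shows "P i"
proof -
  have *: "P ((j + d) mod n)" for d
  proof (induction d)
    case (Suc d)
    from step[OF _ Suc] show ?case
      using \<open>j < n\<close> by (simp add: rnbr_def mod_Suc_eq)
  qed (use assms in simp)
  have "(j + (n - j + i)) mod n = i"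
    using \<open>j < n\<close> \<open>i < n\<close> by simp
  with * show ?thesis by metis
qed

lemma local_update_alt:
  "local_update k n i y =
     y[i := wolfram_fun k (y ! lnbr n i) (y ! i) (y ! rnbr n i)]"
  by (simp add: local_update_def lnbr_def rnbr_def)

lemma length_local_update [simp]: "length (local_update k n i y) = length y"
  by (simp add: local_update_def)

definition fixed_states :: "nat \<Rightarrow> nat \<Rightarrow> bit list set" where
  "fixed_states k n = {y \<in> states n. \<forall>i<n. local_update k n i y = y}"

section \<open>Quadratic energies\<close>

definition energy :: "(bit \<Rightarrow> bit \<Rightarrow> int) \<Rightarrow> nat \<Rightarrow> bit list \<Rightarrow> int" where
  "energy g n y = (\<Sum>i<n. g (y ! i) (y ! rnbr n i))"

text \<open>
  Only the summands of the edges to the left and right of \<open>i\<close> change; they are distinct edges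
  because \<open>n > 1\<close>.
\<close>

lemma energy_list_update:
  assumes "n > 1" "i < n" "length y = n"
  shows "energy g n (y[i := b]) =
    energy g n y + (g (y ! lnbr n i) b + g b (y ! rnbr n i))
      - (g (y ! lnbr n i) (y ! i) + g (y ! i) (y ! rnbr n i))"
proof -
  let ?l = "lnbr n i"
  note neq = nbr_neq[OF assms(1,2)]
  have split: "(\<Sum>j<n. h j) = h i + h ?l + (\<Sum>j\<in>{..<n} - {i, ?l}. h j)" for h :: "nat \<Rightarrow> int"
  proof -
    have "(\<Sum>j<n. h j) = (\<Sum>j\<in>{i, ?l}. h j) + (\<Sum>j\<in>{..<n} - {i, ?l}. h j)"
      using assms by (subst sum.subset_diff[of "{i, ?l}"]) auto
    with neq show ?thesis by auto
  qed
  have "rnbr n j \<noteq> i" if "j < n" "j \<noteq> ?l" for j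
    using that by (metis lnbr_rnbr)
  hence "y[i := b] ! rnbr n j = y ! rnbr n j" if "j < n" "j \<noteq> ?l" for j
    using that nth_list_update_neq by metis
  hence rest: "(\<Sum>j\<in>{..<n} - {i, ?l}. g (y[i := b] ! j) (y[i := b] ! rnbr n j)) =
      (\<Sum>j\<in>{..<n} - {i, ?l}. g (y ! j) (y ! rnbr n j))"
    by (intro sum.cong) (auto simp: nth_list_update)
  show ?thesis
    unfolding energy_def split rest
    using neq assms by (simp add: nth_list_update)
qed

section \<open>Periodic trajectories\<close>

text \<open>
  One local update per time step, the order being repeated cyclically.  This refines iteration of
  the system update, so that arguments can look at the moments inside a sweep.
\<close>

primrec traj :: "nat \<Rightarrow> nat \<Rightarrow> nat list \<Rightarrow> bit list \<Rightarrow> nat \<Rightarrow> bit list" where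
  "traj k n \<pi> y 0 = y"
| "traj k n \<pi> y (Suc t) = local_update k n (\<pi> ! (t mod n)) (traj k n \<pi> y t)"

lemma traj_sweeps:
  assumes "length \<pi> = n"
  shows "traj k n \<pi> y (q * n) = (system_update k n \<pi> ^^ q) y"
proof (induction q)
  case (Suc q)
  have "traj k n \<pi> y (q * n + j) = fold (local_update k n) (take j \<pi>) (traj k n \<pi> y (q * n))"
    if "j \<le> n" for j
    using that
  proof (induction j)
    case (Suc j)
    thus ?case using assms by (simp add: take_Suc_conv_app_nth)
  qed simp
  from this[of n] show ?case
    using assms Suc by (simp add: system_update_def add.commute)
qed simp

locale periodic_orbit =
  fixes k n :: nat and \<pi> :: "nat list" and y :: "bit list" and m :: nat
  assumes n_gt_1: "n > 1"
    and order: "simple_update_order n \<pi>"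
    and state: "y \<in> states n"
    and m_pos: "m > 0"
    and period: "(system_update k n \<pi> ^^ m) y = y"
begin

abbreviation x :: "nat \<Rightarrow> bit list" where "x \<equiv> traj k n \<pi> y"

definition sched :: "nat \<Rightarrow> nat" where "sched t = \<pi> ! (t mod n)"

definition lval :: "nat \<Rightarrow> bit" where "lval t = x t ! lnbr n (sched t)"
definition val :: "nat \<Rightarrow> bit" where "val t = x t ! sched t"
definition rval :: "nat \<Rightarrow> bit" where "rval t = x t ! rnbr n (sched t)"
definition newval :: "nat \<Rightarrow> bit" where "newval t = wolfram_fun k (lval t) (val t) (rval t)"

lemma n_pos: "0 < n"
  using n_gt_1 by simp

lemma length_order: "length \<pi> = n"
  using order distinct_card[of \<pi>] by (simp add: simple_update_order_def)

lemma sched_lt [simp]: "sched t < n"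
  using order length_order n_pos nth_mem[of "t mod n" \<pi>]
  by (simp add: sched_def simple_update_order_def)

lemma length_x [simp]: "length (x t) = n"
  using state by (induction t) (auto simp: states_def)

lemma x_Suc: "x (Suc t) = (x t)[sched t := newval t]"
  by (simp add: local_update_alt sched_def newval_def lval_def val_def rval_def)

declare traj.simps(2) [simp del]

lemma x_Suc_sched: "x (Suc t) ! sched t = newval t"
  by (simp add: x_Suc)

lemma x_Suc_other: "i \<noteq> sched t \<Longrightarrow> x (Suc t) ! i = x t ! i"
  by (simp add: x_Suc)

lemma x_Suc_eq_iff: "x (Suc t) = x t \<longleftrightarrow> newval t = val t"
  by (metis x_Suc x_Suc_sched val_def list_update_id)

lemma sched_add_period: "sched (t + q * n) = sched t"
  by (simp add: sched_def)

lemma x_add_period: "x (t + m * n) = x t"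
proof (induction t)
  case 0
  show ?case using traj_sweeps[OF length_order] period by simp
next
  case (Suc t)
  thus ?case
    using traj.simps(2)[of k n \<pi> y "t + m * n"] traj.simps(2)[of k n \<pi> y t] by simp
qed

text \<open>
  Together with the next lemma: each cell is updated exactly once in any \<open>n\<close> consecutive steps, so
  that the updates of two cells alternate.
\<close>

lemma sched_within_sweep:
  assumes "i < n"
  obtains s where "t < s" "s \<le> t + n" "sched s = i"
proof -
  obtain p where p: "p < n" "\<pi> ! p = i"
    using order assms length_order unfolding simple_update_order_def
    by (metis in_set_conv_nth lessThan_iff)
  define q where "q = Suc t mod n"
  have q: "q < n" "(Suc t + (p + (n - q))) mod n = p"
  proof -
    show "q < n" using n_pos by (simp add: q_def)
    hence "(q + (p + (n - q))) mod n = p" using p by simp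
    thus "(Suc t + (p + (n - q))) mod n = p" by (metis q_def mod_add_left_eq)
  qed
  show thesis
  proof (rule that)
    let ?s = "Suc t + (p + (n - q)) mod n"
    show "t < ?s" by simp
    have "(p + (n - q)) mod n < n" using n_pos by simp
    thus "?s \<le> t + n" by simp
    have "?s mod n = p" using q(2) by (metis mod_add_right_eq)
    thus "sched ?s = i" using p by (simp add: sched_def)
  qed
qed

lemma sched_once_per_sweep:
  assumes "s < s'" "s' < s + n"
  shows "sched s' \<noteq> sched s"
proof
  assume "sched s' = sched s"
  hence "s' mod n = s mod n"
    using order length_order n_pos
    by (simp add: sched_def simple_update_order_def nth_eq_iff_index_eq)
  hence "n dvd s' - s"
    using assms by (simp add: mod_eq_dvd_iff_nat)
  with assms show False by (auto dest: dvd_imp_le)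
qed

lemma unscheduled_unchanged:
  assumes "s \<le> s'" "\<And>r. s \<le> r \<Longrightarrow> r < s' \<Longrightarrow> sched r \<noteq> i"
  shows "x s' ! i = x s ! i"
  using assms
proof (induction s' rule: dec_induct)
  case (step r)
  have "sched r \<noteq> i" using step by auto
  moreover have "x r ! i = x s ! i" using step by auto
  ultimately show ?case by (metis x_Suc_other)
qed simp

lemma quiet_imp_fixed:
  assumes "\<And>t. newval t = val t"
  shows "y \<in> fixed_states k n"
proof -
  have const: "x t = y" for t
    using assms x_Suc_eq_iff by (induction t) auto
  have "local_update k n i y = y" if i: "i < n" for i
  proof -
    obtain t where "sched t = i" using sched_within_sweep[OF i] by metis
    thus ?thesis using traj.simps(2)[of k n \<pi> y t] const by (simp add: sched_def)
  qed
  with state show ?thesis by (simp add: fixed_states_def)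
qed

text \<open>
  After \<open>m\<close> sweeps the trajectory has returned, so a quantity that decreased once could never
  recover its value.
\<close>

lemma monotone_imp_constant:
  fixes \<phi> :: "bit list \<Rightarrow> int"
  assumes "\<And>t. \<phi> (x (Suc t)) \<le> \<phi> (x t)"
  shows "\<phi> (x (Suc t)) = \<phi> (x t)"
proof (rule antisym)
  have "\<phi> (x (Suc t + d)) \<le> \<phi> (x (Suc t))" for d
  proof (induction d)
    case (Suc d)
    with assms[of "Suc t + d"] show ?case by simp
  qed simp
  from this[of "m * n - 1"] show "\<phi> (x t) \<le> \<phi> (x (Suc t))"
    using m_pos n_pos x_add_period[of t] by simp
qed (rule assms)

lemma energy_step:
  "energy g n (x (Suc t)) =
     energy g n (x t) + (g (lval t) (newval t) + g (newval t) (rval t))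
       - (g (lval t) (val t) + g (val t) (rval t))"
  using energy_list_update[OF n_gt_1 sched_lt length_x]
  by (simp add: x_Suc lval_def val_def rval_def)

lemma fixed_if_energy_decreases:
  fixes g :: "bit \<Rightarrow> bit \<Rightarrow> int"
  assumes dec: "\<And>a b c. wolfram_fun k a b c \<noteq> b \<Longrightarrow>
    g a (wolfram_fun k a b c) + g (wolfram_fun k a b c) c < g a b + g b c"
  shows "y \<in> fixed_states k n"
proof (rule quiet_imp_fixed)
  have strict: "energy g n (x (Suc t)) < energy g n (x t)" if "newval t \<noteq> val t" for t
    using dec[of "lval t" "val t" "rval t"] that energy_step[of g t] by (simp add: newval_def)
  have "energy g n (x (Suc t)) \<le> energy g n (x t)" for t
    using strict[of t] x_Suc_eq_iff[of t] by fastforce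
  hence "energy g n (x (Suc t)) = energy g n (x t)" for t
    by (rule monotone_imp_constant)
  with strict show "newval t = val t" for t
    by (metis less_irrefl)
qed

text \<open>
  Suppose that cell \<open>v\<close> turns from \<open>0\<close> to \<open>1\<close>.  It was \<open>0\<close> ever since its previous update, and in
  between its left neighbour was updated, seeing a \<open>0\<close> on its right and hence becoming \<open>0\<close>.  But
  the left neighbour must be \<open>1\<close> when \<open>v\<close> turns to \<open>1\<close>.  Without such births the number of ones
  never increases, so it is constant and no cell dies either.
\<close>

lemma fixed_if_no_births:
  assumes right0: "\<And>a b. wolfram_fun k a b 0 = 0"
    and left1: "\<And>a c. wolfram_fun k a 0 c = 1 \<Longrightarrow> a = 1"
  shows "y \<in> fixed_states k n"
proof -
  have no_birth: "newval t = 0" if "val t = 0" for t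
  proof (rule ccontr)
    assume "newval t \<noteq> 0"
    hence new: "newval t = 1" by simp
    \<comment> \<open>The event is moved one period later, so that a previous update of \<open>v\<close> exists.\<close>
    define T where "T = t + m * n"
    define v where "v = sched t"
    define l where "l = lnbr n v"
    have v: "v < n" "sched T = v" by (simp_all add: v_def T_def sched_add_period)
    have l: "l < n" "l \<noteq> v" "rnbr n l = v"
      using v nbr_neq[OF n_gt_1] by (simp_all add: l_def)
    have "T \<ge> n" using m_pos by (simp add: T_def trans_le_add2)
    have xT: "x T = x t" by (simp add: T_def x_add_period)
    have "x T ! v = 0" using that xT by (simp add: val_def v_def)
    have "lval t = 1" using new left1 that by (simp add: newval_def)
    hence "x T ! l = 1" using xT by (simp add: lval_def l_def v_def)
    obtain s where s: "T - n < s" "s \<le> T - n + n" "sched s = l"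
      using sched_within_sweep[OF l(1)] .
    have "s < T" using s l v \<open>T \<ge> n\<close> by (metis le_add_diff_inverse2 le_neq_implies_less)
    have "x T ! v = x s ! v"
      using sched_once_per_sweep[of _ T] s v \<open>s < T\<close>
      by (intro unscheduled_unchanged) fastforce+
    hence "rval s = 0"
      using \<open>x T ! v = 0\<close> s l by (simp add: rval_def)
    hence "x (Suc s) ! l = 0"
      using x_Suc_sched[of s] right0 s by (simp add: newval_def)
    moreover have "x T ! l = x (Suc s) ! l"
      using sched_once_per_sweep[of s] s \<open>s < T\<close>
      by (intro unscheduled_unchanged) auto
    ultimately show False using \<open>x T ! l = 1\<close> by simp
  qed
  let ?g = "\<lambda>b c. of_bool (b = 1) :: int"
  have le: "energy ?g n (x (Suc t)) \<le> energy ?g n (x t)" for t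
    using no_birth[of t] energy_step[of ?g t] by (cases "val t") auto
  have "newval t = val t" for t
    using monotone_imp_constant[OF le, of t] no_birth[of t] energy_step[of ?g t]
    by (cases "val t"; cases "newval t") auto
  thus ?thesis by (rule quiet_imp_fixed)
qed

text \<open>
  The hypotheses say that a \<open>0\<close> with left neighbour \<open>0\<close> stays \<open>0\<close> and that a \<open>1\<close> copies its right
  neighbour.  Then no update creates a pair \<open>01\<close>, so on a periodic trajectory none is destroyed,
  and a change can only occur with left neighbour \<open>1\<close> and right neighbour \<open>0\<close>.  If a cell dies,
  its left neighbour is \<open>1\<close> and, at its own next update, sees a \<open>0\<close> on its right; so it dies
  too.  Going around the circle, every cell dies at some later time.  This contradicts the
  existence of a pair \<open>01\<close>, whose cells keep each other from changing.
\<close>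

lemma fixed_if_boundary_drifts:
  assumes left0: "\<And>c. wolfram_fun k 0 0 c = 0"
    and right: "\<And>a c. wolfram_fun k a 1 c = c"
  shows "y \<in> fixed_states k n"
proof (rule quiet_imp_fixed, rule ccontr)
  let ?g = "\<lambda>b c. of_bool (b = 0 \<and> c = 1) :: int"
  have le: "energy ?g n (x (Suc t)) \<le> energy ?g n (x t)" for t
    using energy_step[of ?g t] left0 right
    by (cases "lval t"; cases "val t"; cases "rval t"; cases "newval t") (auto simp: newval_def)
  have change: "lval t = 1 \<and> rval t = 0" if "newval t \<noteq> val t" for t
    using energy_step[of ?g t] monotone_imp_constant[OF le, of t] left0 right that
    by (cases "lval t"; cases "val t"; cases "rval t"; cases "newval t") (auto simp: newval_def)
  define dies where "dies t i \<longleftrightarrow> sched t = i \<and> val t = 1 \<and> newval t = 0" for t i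
  fix t0 assume t0: "newval t0 \<noteq> val t0"

  \<comment> \<open>Some cell dies: a cell that is born has to die again, since the trajectory returns.\<close>
  obtain T where T: "dies T (sched t0)"
  proof (cases "val t0 = 1")
    case True
    with t0 show ?thesis using that by (auto simp: dies_def)
  next
    case False
    hence "val t0 = 0" by simp
    show ?thesis
    proof (rule ccontr)
      assume no: "\<not> thesis"
      have stays: "x (Suc t0 + d) ! sched t0 = 1" for d
      proof (induction d)
        case 0
        show ?case using t0 \<open>val t0 = 0\<close> by (simp add: x_Suc_sched)
      next
        case (Suc d)
        show ?case
        proof (cases "sched (Suc t0 + d) = sched t0")
          case True
          with Suc have "val (Suc t0 + d) = 1" by (simp add: val_def)
          with True no that have "newval (Suc t0 + d) = 1"
            unfolding dies_def by (metis bit_not_zero_iff)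
          with True show ?thesis using x_Suc_sched[of "Suc t0 + d"] by simp
        next
          case False
          with Suc show ?thesis using x_Suc_other[of "sched t0" "Suc t0 + d"] by simp
        qed
      qed
      from stays[of "m * n - 1"] have "x t0 ! sched t0 = 1"
        using m_pos n_pos x_add_period[of t0] by simp
      with \<open>val t0 = 0\<close> show False by (simp add: val_def)
    qed
  qed

  have propagate: "\<exists>s\<ge>T. dies s (lnbr n i)" if "i < n" "\<exists>s\<ge>T. dies s i" for i
  proof -
    from that obtain s where s: "s \<ge> T" "dies s i" by blast
    let ?l = "lnbr n i"
    have "?l < n" "?l \<noteq> i" using that nbr_neq[OF n_gt_1] by auto
    obtain s' where s': "s < s'" "s' \<le> s + n" "sched s' = ?l"
      and first: "\<And>r. s < r \<Longrightarrow> r < s' \<Longrightarrow> sched r \<noteq> ?l"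
    proof -
      obtain s' where s': "s < s'" "s' \<le> s + n" "sched s' = ?l"
        using sched_within_sweep[OF \<open>?l < n\<close>] .
      show thesis
        using sched_once_per_sweep[of _ s'] s' by (intro that[OF s']) fastforce
    qed
    have "s' \<noteq> s + n"
      using s' s \<open>?l \<noteq> i\<close> sched_add_period[of s 1] by (auto simp: dies_def)
    have "x s' ! i = x (Suc s) ! i"
      using sched_once_per_sweep[of s] s s' by (intro unscheduled_unchanged) (auto simp: dies_def)
    also have "\<dots> = 0" using s x_Suc_sched[of s] by (auto simp: dies_def)
    finally have "rval s' = 0" using s' that by (simp add: rval_def)
    moreover have "val s' = 1"
    proof -
      have "x s' ! ?l = x s ! ?l"
        using first s' s \<open>?l \<noteq> i\<close>
        by (intro unscheduled_unchanged) (auto simp: dies_def le_less)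
      also have "\<dots> = 1"
        using change[of s] s by (auto simp: dies_def lval_def)
      finally show ?thesis using s' by (simp add: val_def)
    qed
    ultimately have "dies s' ?l" using s' right by (simp add: dies_def newval_def)
    thus ?thesis using s s' by (meson less_imp_le_nat order_trans)
  qed

  \<comment> \<open>Dying spreads to the left, so not dying spreads to the right.\<close>
  have all_die: "\<exists>s\<ge>T. dies s i" if "i < n" for i
  proof (rule ccontr)
    assume no: "\<not> ?thesis"
    have "\<not> (\<exists>s\<ge>T. dies s (sched t0))"
    proof (rule spread_right[of n "\<lambda>i. \<not> (\<exists>s\<ge>T. dies s i)" i, OF _ that no sched_lt])
      fix j assume "j < n" "\<not> (\<exists>s\<ge>T. dies s j)"
      thus "\<not> (\<exists>s\<ge>T. dies s (rnbr n j))"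
        using propagate[of "rnbr n j"] by auto
    qed
    with T show False by blast
  qed

  obtain i where i: "i < n" "x T ! i = 0" "x T ! rnbr n i = 1"
  proof (rule ccontr)
    assume no: "\<not> thesis"
    have "rval T = 0" using change[of T] T by (auto simp: dies_def)
    hence "x T ! rnbr n (sched T) = 0" by (simp add: rval_def)
    have "x T ! sched T = 0"
    proof (rule spread_right[of n "\<lambda>i. x T ! i = 0", OF _ _ \<open>x T ! rnbr n (sched T) = 0\<close>])
      fix j assume "j < n" "x T ! j = 0"
      with no that[of j] show "x T ! rnbr n j = 0" by (metis bit_not_one_iff)
    qed simp_all
    with T show False by (auto simp: dies_def val_def)
  qed
  have frozen: "x (T + d) ! i = 0 \<and> x (T + d) ! rnbr n i = 1" for d
  proof (induction d)
    case (Suc d)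
    have "newval (T + d) = val (T + d)" if "sched (T + d) = i \<or> sched (T + d) = rnbr n i"
    proof (rule ccontr)
      assume "newval (T + d) \<noteq> val (T + d)"
      from change[OF this] Suc that i(1) show False by (auto simp: lval_def rval_def)
    qed
    thus ?case
      using Suc x_Suc_sched[of "T + d"] x_Suc_other[of _ "T + d"]
      by (metis add_Suc_right val_def)
  qed (use i in simp)
  obtain s where "s \<ge> T" "dies s (rnbr n i)" using all_die[of "rnbr n i"] i(1) by auto
  moreover from this frozen[of "s - T"] have "x s ! i = 0" by simp
  ultimately show False using change[of s] i(1) by (auto simp: dies_def lval_def)
qed

end

section \<open>Periodic states are fixed\<close>

lemma all_bit: "(\<forall>b::bit. P b) \<longleftrightarrow> P 0 \<and> P 1"
  by (metis (full_types) bit_not_one_iff)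

lemmas wolfram_table = all_bit wolfram_fun_def wolfram_digit_def

lemma fixed_subset_periodic:
  assumes "simple_update_order n \<pi>"
  shows "fixed_states k n \<subseteq> periodic_states k n \<pi>"
proof
  fix y assume y: "y \<in> fixed_states k n"
  have "fold (local_update k n) is y = y" if "set is \<subseteq> {..<n}" for "is"
    using that y by (induction "is") (auto simp: fixed_states_def)
  hence "system_update k n \<pi> y = y"
    using assms by (simp add: system_update_def simple_update_order_def)
  hence "(system_update k n \<pi> ^^ 1) y = y" by simp
  with y show "y \<in> periodic_states k n \<pi>"
    unfolding periodic_states_def fixed_states_def by blast
qed

text \<open>
  In the first case no rule ever creates a one.  In the second the only births are
  \<open>101 \<rightarrow> 111\<close>, which remove two boundaries at the price of one new one, while a death adds no
  boundary.  In the third the births (\<open>000 \<rightarrow> 010\<close>) create no pair \<open>11\<close>, while every death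
  destroys at least one such pair.
\<close>

lemma orbit_fixed_if_listed:
  assumes "periodic_orbit k n \<pi> y m" "k \<in> listed_rules"
  shows "y \<in> fixed_states k n"
proof -
  interpret periodic_orbit k n \<pi> y m by fact
  let ?f = "wolfram_fun k"
  define dec where "dec g \<longleftrightarrow>
    (\<forall>a b c. ?f a b c \<noteq> b \<longrightarrow> g a (?f a b c) + g (?f a b c) c < g a b + g b c)"
    for g :: "bit \<Rightarrow> bit \<Rightarrow> int"
  have energy: "y \<in> fixed_states k n" if "dec g" for g
    using that unfolding dec_def by (intro fixed_if_energy_decreases[of g]) blast
  consider "k \<in> {0, 8, 128, 136, 4, 12, 132, 140, 72, 76, 200, 204}"
    | "k \<in> {160, 168, 164, 172, 232}"
    | "k \<in> {5, 13, 133, 141, 77}"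
    | "k \<in> {32, 40}"
    | "k \<in> {152, 184}"
    using assms(2) unfolding listed_rules_def by blast
  thus ?thesis
  proof cases
    case 1
    hence "dec (\<lambda>b c. of_bool (b = 1))"
      unfolding dec_def by (elim insertE emptyE; simp add: wolfram_table)
    thus ?thesis by (rule energy)
  next
    case 2
    hence "dec (\<lambda>b c. of_bool (b \<noteq> c) + of_bool (b = 1))"
      unfolding dec_def by (elim insertE emptyE; simp add: wolfram_table)
    thus ?thesis by (rule energy)
  next
    case 3
    hence "dec (\<lambda>b c. 2 * of_bool (b = 1 \<and> c = 1) - of_bool (b = 1))"
      unfolding dec_def by (elim insertE emptyE; simp add: wolfram_table)
    thus ?thesis by (rule energy)
  next
    case 4
    hence "(\<forall>a b. ?f a b 0 = 0) \<and> (\<forall>a c. ?f a 0 c = 1 \<longrightarrow> a = 1)"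
      by (elim insertE emptyE; simp add: wolfram_table)
    thus ?thesis by (intro fixed_if_no_births) blast+
  next
    case 5
    hence "(\<forall>c. ?f 0 0 c = 0) \<and> (\<forall>a c. ?f a 1 c = c)"
      by (elim insertE emptyE; simp add: wolfram_table)
    thus ?thesis by (intro fixed_if_boundary_drifts) blast+
  qed
qed

theorem periodic_eq_fixed:
  assumes "n > 1" "simple_update_order n \<pi>" "k \<in> listed_rules"
  shows "periodic_states k n \<pi> = fixed_states k n"
proof
  show "periodic_states k n \<pi> \<subseteq> fixed_states k n"
  proof
    fix y assume "y \<in> periodic_states k n \<pi>"
    then obtain m where "periodic_orbit k n \<pi> y m"
      using assms unfolding periodic_states_def periodic_orbit_def by blast
    thus "y \<in> fixed_states k n" using orbit_fixed_if_listed assms(3) by blast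
  qed
qed (use fixed_subset_periodic assms in blast)

section \<open>The dynamics group on fixed states\<close>

lemma carrier_dynamics_group_fixed:
  assumes "n > 0"
  shows "carrier (dynamics_group k n (fixed_states k n)) = {\<one>\<^bsub>BijGroup (fixed_states k n)\<^esub>}"
proof -
  let ?P = "fixed_states k n"
  have "restrict (local_update k n i) ?P = \<one>\<^bsub>BijGroup ?P\<^esub>" if "i < n" for i
    using that by (simp add: BijGroup_def) (rule restrict_ext, simp add: fixed_states_def)
  hence "(\<lambda>i. restrict (local_update k n i) ?P) ` {..<n} = {\<one>\<^bsub>BijGroup ?P\<^esub>}"
    using assms by auto
  thus ?thesis
    by (simp add: dynamics_group_def group.generate_one[OF group_BijGroup])
qed

lemma trivial_dynamics_group_fixed:
  assumes "n > 0"
  shows "trivial_group (dynamics_group k n (fixed_states k n))"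
proof -
  let ?B = "BijGroup (fixed_states k n)" and ?G = "dynamics_group k n (fixed_states k n)"
  have G: "?G = ?B\<lparr>carrier := {\<one>\<^bsub>?B\<^esub>}\<rparr>"
    using carrier_dynamics_group_fixed[OF assms, of k] by (simp add: dynamics_group_def)
  have "group ?G"
    unfolding G
    using group.triv_subgroup[OF group_BijGroup] group_BijGroup
    by (rule subgroup.subgroup_is_group)
  thus ?thesis
    unfolding trivial_group_def using carrier_dynamics_group_fixed[OF assms, of k] G by simp
qed

lemma num_orbits_fixed:
  assumes "n > 0"
  shows "num_orbits k n (fixed_states k n) = card (fixed_states k n)"
proof -
  let ?P = "fixed_states k n"
  have "orbit (dynamics_group k n ?P) (\<lambda>g. g) y = {y}" if "y \<in> ?P" for y
    using that
    by (simp add: orbit_def carrier_dynamics_group_fixed[OF assms]) (simp add: BijGroup_def)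
  hence "orbits (dynamics_group k n ?P) ?P (\<lambda>g. g) = (\<lambda>y. {y}) ` ?P"
    by (auto simp: orbits_def)
  thus ?thesis by (simp add: num_orbits_def card_image)
qed

section \<open>Fixed states by forbidden windows\<close>

definition window_states :: "nat \<Rightarrow> (bit \<Rightarrow> bit \<Rightarrow> bit \<Rightarrow> bool) \<Rightarrow> bit list set" where
  "window_states n ok = {y \<in> states n. \<forall>i<n. ok (y ! lnbr n i) (y ! i) (y ! rnbr n i)}"

definition stable :: "nat \<Rightarrow> bit \<Rightarrow> bit \<Rightarrow> bit \<Rightarrow> bool" where
  "stable k a b c \<longleftrightarrow> wolfram_fun k a b c = b"

lemma fixed_states_eq_window_states: "fixed_states k n = window_states n (stable k)"
proof -
  have "local_update k n i y = y \<longleftrightarrow> stable k (y ! lnbr n i) (y ! i) (y ! rnbr n i)"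
    if "i < n" "length y = n" for i y
    using that unfolding local_update_alt stable_def
    by (metis list_update_id nth_list_update_eq)
  thus ?thesis
    by (auto simp: fixed_states_def window_states_def states_def)
qed

lemma window_statesD:
  "y \<in> window_states n ok \<Longrightarrow> i < n \<Longrightarrow> ok (y ! lnbr n i) (y ! i) (y ! rnbr n i)"
  by (simp add: window_states_def)

lemma window_statesD_lnbr:
  "y \<in> window_states n ok \<Longrightarrow> i < n \<Longrightarrow> ok (y ! lnbr n (lnbr n i)) (y ! lnbr n i) (y ! i)"
  using window_statesD[of y n ok "lnbr n i"] by simp

lemma window_statesD_rnbr:
  "y \<in> window_states n ok \<Longrightarrow> i < n \<Longrightarrow> ok (y ! i) (y ! rnbr n i) (y ! rnbr n (rnbr n i))"
  using window_statesD[of y n ok "rnbr n i"] by simp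

text \<open>
  Stability of single windows need not match the forbidden words: for rule 12 the window \<open>011\<close> is
  stable although \<open>11\<close> is forbidden, because no window \<open>11c\<close> is stable.  Comparing overlapping
  windows makes the equality of the global conditions a check over four bits.
\<close>

lemma window_states_eqI:
  assumes fwd: "\<forall>a b c d. ok a b c \<and> ok b c d \<longrightarrow> ok' b c d"
    and conv: "\<forall>a b c d. ok' a b c \<and> ok' b c d \<longrightarrow> ok a b c"
  shows "window_states n ok = window_states n ok'"
proof (intro equalityI subsetI)
  fix y assume y: "y \<in> window_states n ok"
  have "ok' (y ! lnbr n i) (y ! i) (y ! rnbr n i)" if "i < n" for i
    using fwd window_statesD_lnbr[OF y that] window_statesD[OF y that] by blast
  with y show "y \<in> window_states n ok'" by (simp add: window_states_def)
next
  fix y assume y: "y \<in> window_states n ok'"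
  have "ok (y ! lnbr n i) (y ! i) (y ! rnbr n i)" if "i < n" for i
    using conv window_statesD[OF y that] window_statesD_rnbr[OF y that] by blast
  with y show "y \<in> window_states n ok" by (simp add: window_states_def)
qed

text \<open>
  Same comparison when stability tolerates a pair \<open>11\<close> only if the next cell is \<open>1\<close> again: a single
  violation of \<open>ok'\<close> then spreads around the circle and forces the all-one state.
\<close>

lemma window_states_eq_insert_one:
  assumes fwd: "\<forall>a b c d. ok a b c \<and> ok b c d \<longrightarrow> ok' b c d \<or> b = 1 \<and> c = 1"
    and conv: "\<forall>a b c d. ok' a b c \<and> ok' b c d \<longrightarrow> ok a b c"
    and spread: "\<forall>d. ok 1 1 d \<longrightarrow> d = 1"
    and one: "ok 1 1 1"
  shows "window_states n ok = window_states n ok' \<union> {one_state n}"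
proof (intro equalityI subsetI)
  fix y assume y: "y \<in> window_states n ok"
  show "y \<in> window_states n ok' \<union> {one_state n}"
  proof (cases "y \<in> window_states n ok'")
    case False
    with y obtain j where j: "j < n" "\<not> ok' (y ! lnbr n j) (y ! j) (y ! rnbr n j)"
      by (auto simp: window_states_def)
    hence seed: "y ! lnbr n j = 1 \<and> y ! j = 1"
      using fwd window_statesD_lnbr[OF y] window_statesD[OF y] by blast
    have "y ! lnbr n i = 1 \<and> y ! i = 1" if "i < n" for i
    proof (rule spread_right[of n "\<lambda>i. y ! lnbr n i = 1 \<and> y ! i = 1" j, OF _ j(1) seed that])
      fix i assume "i < n" "y ! lnbr n i = 1 \<and> y ! i = 1"
      thus "y ! lnbr n (rnbr n i) = 1 \<and> y ! rnbr n i = 1"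
        using spread window_statesD[OF y, of i] by simp
    qed
    with y have "y = one_state n"
      by (intro nth_equalityI) (auto simp: window_states_def states_def one_state_def)
    thus ?thesis by simp
  qed simp
next
  fix y assume "y \<in> window_states n ok' \<union> {one_state n}"
  thus "y \<in> window_states n ok"
  proof
    assume y: "y \<in> window_states n ok'"
    have "ok (y ! lnbr n i) (y ! i) (y ! rnbr n i)" if "i < n" for i
      using conv window_statesD[OF y that] window_statesD_rnbr[OF y that] by blast
    with y show ?thesis by (simp add: window_states_def)
  next
    assume "y \<in> {one_state n}"
    with one show ?thesis
      by (auto simp: window_states_def one_state_def states_def)
  qed
qed

text \<open>
  The condition is put on the left cell to fit the overlap in the two comparison lemmas.
\<close>

lemma window_states_left_zero: "window_states n (\<lambda>a b c. a = 0) = {zero_state n}"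
proof -
  have "y \<in> window_states n (\<lambda>a b c. a = 0) \<longleftrightarrow> y = zero_state n" for y
    using all_lnbr[of n "\<lambda>i. y ! i = 0"]
    by (auto simp: window_states_def zero_state_def states_def list_eq_iff_nth_eq)
  thus ?thesis by blast
qed

lemma cyclic_subword_2:
  assumes "length y = n"
  shows "cyclic_subword [p, q] y \<longleftrightarrow> (\<exists>i<n. y ! lnbr n i = p \<and> y ! i = q)"
proof -
  have "cyclic_subword [p, q] y \<longleftrightarrow> (\<exists>i<n. y ! i = p \<and> y ! rnbr n i = q)"
    using assms by (auto simp: cyclic_subword_def rnbr_def less_Suc_eq)
  also have "\<dots> \<longleftrightarrow> (\<exists>i<n. y ! lnbr n i = p \<and> y ! i = q)"
    using all_lnbr[of n "\<lambda>i. \<not> (y ! i = p \<and> y ! rnbr n i = q)"] by auto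
  finally show ?thesis .
qed

lemma cyclic_subword_3:
  assumes "length y = n"
  shows "cyclic_subword [p, q, r] y \<longleftrightarrow>
    (\<exists>i<n. y ! lnbr n i = p \<and> y ! i = q \<and> y ! rnbr n i = r)"
proof -
  have "cyclic_subword [p, q, r] y \<longleftrightarrow>
      (\<exists>i<n. y ! i = p \<and> y ! rnbr n i = q \<and> y ! rnbr n (rnbr n i) = r)"
    using assms
    by (auto simp: cyclic_subword_def rnbr_def less_Suc_eq mod_Suc_eq numeral_2_eq_2)
  also have "\<dots> \<longleftrightarrow> (\<exists>i<n. y ! lnbr n i = p \<and> y ! i = q \<and> y ! rnbr n i = r)"
    using all_lnbr[of n "\<lambda>i. \<not> (y ! i = p \<and> y ! rnbr n i = q \<and> y ! rnbr n (rnbr n i) = r)"]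
    by auto
  finally show ?thesis .
qed

lemma avoiding_eq_window_states:
  "avoiding n {word_A} = window_states n (\<lambda>a b c. \<not> (a = 1 \<and> b = 1))"
  "avoiding n {word_A, word_B} =
     window_states n (\<lambda>a b c. \<not> (a = 1 \<and> b = 1) \<and> \<not> (a = 0 \<and> b = 0 \<and> c = 0))"
  "avoiding n {word_A, word_E} =
     window_states n (\<lambda>a b c. \<not> (a = 1 \<and> b = 1) \<and> \<not> (a = 1 \<and> b = 0 \<and> c = 1))"
  "avoiding n {word_B, word_C} =
     window_states n (\<lambda>a b c. \<not> (a = 0 \<and> b = 0 \<and> c = 0) \<and> \<not> (a = 1 \<and> b = 1 \<and> c = 1))"
  "avoiding n {word_C} = window_states n (\<lambda>a b c. \<not> (a = 1 \<and> b = 1 \<and> c = 1))"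
  "avoiding n {word_C, word_D} =
     window_states n (\<lambda>a b c. \<not> (a = 1 \<and> b = 1 \<and> c = 1) \<and> \<not> (a = 0 \<and> b = 1 \<and> c = 0))"
  "avoiding n {word_D} = window_states n (\<lambda>a b c. \<not> (a = 0 \<and> b = 1 \<and> c = 0))"
  "avoiding n {word_D, word_E} =
     window_states n (\<lambda>a b c. \<not> (a = 0 \<and> b = 1 \<and> c = 0) \<and> \<not> (a = 1 \<and> b = 0 \<and> c = 1))"
  unfolding avoiding_def window_states_def states_def
    word_A_def word_B_def word_C_def word_D_def word_E_def
  by (intro Collect_cong conj_cong;
      simp add: cyclic_subword_2 cyclic_subword_3 del: bit_not_zero_iff bit_not_one_iff; blast)+

lemma fixed_states_table:
  "k \<in> {0, 8, 32, 40} \<Longrightarrow> fixed_states k n = {zero_state n}"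
  "k \<in> {128, 136, 160, 168, 152, 184} \<Longrightarrow> fixed_states k n = {zero_state n} \<union> {one_state n}"
  "k \<in> {4, 12} \<Longrightarrow> fixed_states k n = avoiding n {word_A}"
  "k \<in> {132, 140} \<Longrightarrow> fixed_states k n = avoiding n {word_A} \<union> {one_state n}"
  "k \<in> {5, 13} \<Longrightarrow> fixed_states k n = avoiding n {word_A, word_B}"
  "k \<in> {133, 141} \<Longrightarrow> fixed_states k n = avoiding n {word_A, word_B} \<union> {one_state n}"
  "k \<in> {164, 172} \<Longrightarrow> fixed_states k n = avoiding n {word_A, word_E} \<union> {one_state n}"
  "fixed_states 77 n = avoiding n {word_B, word_C}"
  "fixed_states 76 n = avoiding n {word_C}"
  "fixed_states 72 n = avoiding n {word_C, word_D}"
  "fixed_states 200 n = avoiding n {word_D}"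
  "fixed_states 232 n = avoiding n {word_D, word_E}"
  "fixed_states 204 n = states n"
  unfolding fixed_states_eq_window_states avoiding_eq_window_states window_states_left_zero [symmetric]
  by (rule window_states_eqI window_states_eq_insert_one; (elim insertE emptyE)?;
      simp add: stable_def wolfram_table)+
    (simp add: window_states_def stable_def wolfram_fun_def wolfram_digit_def)

theorem mainTheorem7:
  fixes n :: nat and \<pi> :: "nat list"
  assumes "n > 3" and "simple_update_order n \<pi>"
  shows
    "(\<forall>k\<in>listed_rules.
        (\<forall>y\<in>periodic_states k n \<pi>. \<forall>i<n. local_update k n i y = y) \<and>
        trivial_group (dynamics_group k n (periodic_states k n \<pi>)) \<and>
        num_orbits k n (periodic_states k n \<pi>) = card (periodic_states k n \<pi>)) \<and>
     (\<forall>k\<in>{0, 8, 32, 40}. periodic_states k n \<pi> = {zero_state n}) \<and>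
     (\<forall>k\<in>{128, 136, 160, 168, 152, 184}.
        periodic_states k n \<pi> = {zero_state n, one_state n}) \<and>
     (\<forall>k\<in>{4, 12}. periodic_states k n \<pi> = avoiding n {word_A}) \<and>
     (\<forall>k\<in>{132, 140}. periodic_states k n \<pi> = avoiding n {word_A} \<union> {one_state n}) \<and>
     (\<forall>k\<in>{5, 13}. periodic_states k n \<pi> = avoiding n {word_A, word_B}) \<and>
     (\<forall>k\<in>{133, 141}.
        periodic_states k n \<pi> = avoiding n {word_A, word_B} \<union> {one_state n}) \<and>
     (\<forall>k\<in>{164, 172}.
        periodic_states k n \<pi> = avoiding n {word_A, word_E} \<union> {one_state n}) \<and>
     periodic_states 77 n \<pi> = avoiding n {word_B, word_C} \<and>
     periodic_states 76 n \<pi> = avoiding n {word_C} \<and>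
     periodic_states 72 n \<pi> = avoiding n {word_C, word_D} \<and>
     periodic_states 200 n \<pi> = avoiding n {word_D} \<and>
     periodic_states 232 n \<pi> = avoiding n {word_D, word_E} \<and>
     periodic_states 204 n \<pi> = states n"
proof -
  have pos: "n > 0" and gt1: "n > 1" using assms(1) by simp_all
  have eq: "periodic_states k n \<pi> = fixed_states k n" if "k \<in> listed_rules" for k
    using periodic_eq_fixed[OF gt1 assms(2) that] .
  have fixed: "(\<forall>y\<in>periodic_states k n \<pi>. \<forall>i<n. local_update k n i y = y) \<and>
      trivial_group (dynamics_group k n (periodic_states k n \<pi>)) \<and>
      num_orbits k n (periodic_states k n \<pi>) = card (periodic_states k n \<pi>)"
    if "k \<in> listed_rules" for k
    using trivial_dynamics_group_fixed[OF pos] num_orbits_fixed[OF pos]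
    unfolding eq[OF that] by (auto simp: fixed_states_def)
  have listed: "{0, 8, 32, 40, 128, 136, 160, 168, 152, 184, 4, 12, 132, 140, 5, 13, 133, 141,
      164, 172, 77, 76, 72, 200, 232, 204} \<subseteq> listed_rules"
    by (simp add: listed_rules_def)
  show ?thesis
    using fixed fixed_states_table eq listed by simp (rule insert_commute)
qed

end
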